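(* Let $\Bbbk$ be a field of characteristic zero. Let $w$ be a nonnegative integer and let $h\in\Bbbk(x,y)$ be a nonzero element such that $\mathrm{dpb}(\varphi(h))>w$ for every $\Bbbk$-algebra map $\varphi:\Bbbk(x,y)\to\Bbbk(x,y)$. Let $f(t)\in\Bbbk[t]$ be a polynomial of degree at least $2$. Then there is no Poisson algebra morphism from $K\{xyf(h)\}$ to $K\{\mathbf g\}$ for any $\mathbf g\in G_w$.
   Context: For $\mathbf f\in\Bbbk(x,y)$, $K\{\mathbf f\}$ denotes the rational function field $\Bbbk(x,y)$ equipped with the unique ($\Bbbk$-bilinear) Poisson bracket such that $\{x,y\}=\mathbf f$; explicitly $\{g,h\}=\left(\frac{\partial g}{\partial x}\frac{\partial h}{\partial y}-\frac{\partial g}{\partial y}\frac{\partial h}{\partial x}\right)\mathbf f$. Poisson algebra morphisms are $\Bbbk$-algebra homomorphisms preserving Poisson brackets. Let $F=\Bbbk(x,y)$. A fractional frame of $F$ is a pair $\mathbf s=(s_1,s_2)\in F^2$ such that the fraction field of the subalgebra $\Bbbk[s_1,s_2]$ equals $F$ (so $\Bbbk[s_1,s_2]$ is a polynomial ring in $s_1,s_2$). Given $h\in F$ and a fractional frame $\mathbf s$, write $h=f/g$ with $f,g\in\Bbbk[s_1,s_2]$ coprime, and factor $g=p_1^{m_1}\cdots p_v^{m_v}$ (up to a unit) with pairwise non-associate primes $p_j\in\Bbbk[s_1,s_2]$ and $m_j\ge1$ ($v=0$ if $g\in\Bbbk^\times$). The denominator prime-divisor bound $\mathrm{dpb}(h)$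 is the minimum of $v$ over all fractional frames $\mathbf s$ of $F$. For a nonnegative integer $w$, $G_w$ is the set of $\mathbf g\in\Bbbk(x,y)$ such that $\mathbf g=a/b$ for some coprime polynomials $a,b\in\Bbbk[x,y]$ with the number of non-associate prime divisors of $b$ no more than $w$. *)

theory Defs
  imports "HOL-Computational_Algebra.Computational_Algebra"
begin

section \<open>The rational function field in two variables\<close>

text \<open>An element of \<^typ>\<open>'k poly poly\<close> is read as a polynomial in \<open>y\<close> whose
  coefficients are polynomials in \<open>x\<close>, so that \<open>x\<close> is the inner variable.\<close>

type_synonym 'k ratfun2 = "'k poly poly fract"

definition const2 :: "'k::field \<Rightarrow> 'k ratfun2" where
  "const2 c = to_fract [:[:c:]:]"

definition varx :: "'k::field ratfun2" where
  "varx = to_fract [:[:0, 1:]:]"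

definition vary :: "'k::field ratfun2" where
  "vary = to_fract [:0, 1:]"

definition eval_at :: "'k::field poly \<Rightarrow> 'k ratfun2 \<Rightarrow> 'k ratfun2" where
  "eval_at f h = poly (map_poly const2 f) h"

definition algebra_map :: "('k::field ratfun2 \<Rightarrow> 'k ratfun2) \<Rightarrow> bool" where
  "algebra_map \<phi> \<longleftrightarrow>
     (\<forall>a b. \<phi> (a + b) = \<phi> a + \<phi> b) \<and>
     (\<forall>a b. \<phi> (a * b) = \<phi> a * \<phi> b) \<and>
     (\<forall>c. \<phi> (const2 c) = const2 c)"


section \<open>Partial derivatives and the Poisson bracket\<close>

lemma map_poly_pderiv_mult:
  "map_poly pderiv (p * q) = p * map_poly pderiv q + q * map_poly pderiv p"
  for p q :: "'k::field poly poly"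
proof (rule poly_eqI)
  fix n
  have "pderiv (\<Sum>i\<le>n. coeff p i * coeff q (n - i)) =
      (\<Sum>i\<le>n. coeff p i * pderiv (coeff q (n - i))) +
      (\<Sum>i\<le>n. pderiv (coeff p i) * coeff q (n - i))"
    by (simp add: higher_pderiv_sum[of 1, simplified] pderiv_mult sum.distrib mult.commute)
  then show "coeff (map_poly pderiv (p * q)) n =
      coeff (p * map_poly pderiv q + q * map_poly pderiv p) n"
    unfolding mult.commute[of q] by (simp add: coeff_map_poly coeff_mult)
qed

text \<open>The extension of a derivation to fractions by the quotient rule. The value does not
  depend on the chosen representation as a fraction, by the lemma below.\<close>

definition quotient_rule :: "('a::idom \<Rightarrow> 'a) \<Rightarrow> 'a fract \<Rightarrow> 'a fract" where
  "quotient_rule D q =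
     (THE r. \<exists>a b. b \<noteq> 0 \<and> q = Fract a b \<and> r = Fract (D a * b - a * D b) (b\<^sup>2))"

lemma quotient_rule_Fract:
  fixes D :: "'a::idom \<Rightarrow> 'a"
  assumes D: "\<And>p q. D (p * q) = p * D q + q * D p" and "b \<noteq> 0"
  shows "quotient_rule D (Fract a b) = Fract (D a * b - a * D b) (b\<^sup>2)"
  unfolding quotient_rule_def
proof (rule the_equality)
  show "\<exists>a' b'. b' \<noteq> 0 \<and> Fract a b = Fract a' b' \<and>
      Fract (D a * b - a * D b) (b\<^sup>2) = Fract (D a' * b' - a' * D b') (b'\<^sup>2)"
    using \<open>b \<noteq> 0\<close> by blast
next
  fix r assume "\<exists>c d. d \<noteq> 0 \<and> Fract a b = Fract c d \<and> r = Fract (D c * d - c * D d) (d\<^sup>2)"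
  then obtain c d where d: "d \<noteq> 0" "Fract a b = Fract c d"
    and r: "r = Fract (D c * d - c * D d) (d\<^sup>2)" by blast
  have eq: "a * d = c * b"
    using d \<open>b \<noteq> 0\<close> by (simp add: eq_fract)
  have *: "a * D d + d * D a = c * D b + b * D c"
    using arg_cong[OF eq, of D] by (simp add: D)
  have "(D a * b - a * D b) * d\<^sup>2 = b * d * (d * D a) - (a * d) * (d * D b)"
    by (simp add: power2_eq_square algebra_simps)
  also have "\<dots> = b * d * (c * D b + b * D c - a * D d) - (a * d) * (d * D b)"
    using * by (simp add: eq_diff_eq add.commute)
  also have "\<dots> = b * d * (c * D b + b * D c) - b * (a * d) * D d - (a * d) * (d * D b)"
    by (simp add: algebra_simps)
  also have "\<dots> = (D c * d - c * D d) * b\<^sup>2"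
    unfolding eq by (simp add: power2_eq_square algebra_simps)
  finally show "r = Fract (D a * b - a * D b) (b\<^sup>2)"
    using d \<open>b \<noteq> 0\<close> unfolding r by (simp add: eq_fract)
qed

definition deriv_x :: "'k::field ratfun2 \<Rightarrow> 'k ratfun2" where
  "deriv_x = quotient_rule (map_poly pderiv)"

definition deriv_y :: "'k::field ratfun2 \<Rightarrow> 'k ratfun2" where
  "deriv_y = quotient_rule pderiv"

definition bracket :: "'k::field ratfun2 \<Rightarrow> 'k ratfun2 \<Rightarrow> 'k ratfun2 \<Rightarrow> 'k ratfun2" where
  "bracket f g h = (deriv_x g * deriv_y h - deriv_y g * deriv_x h) * f"

text \<open>\<open>poisson_morphism f g\<close> characterises the morphisms from \<open>K{f}\<close> to \<open>K{g}\<close>.\<close>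

definition poisson_morphism ::
  "'k::field ratfun2 \<Rightarrow> 'k ratfun2 \<Rightarrow> ('k ratfun2 \<Rightarrow> 'k ratfun2) \<Rightarrow> bool" where
  "poisson_morphism f g \<phi> \<longleftrightarrow>
     algebra_map \<phi> \<and> (\<forall>a b. \<phi> (bracket f a b) = bracket g (\<phi> a) (\<phi> b))"

lemma deriv_x_Fract:
  "b \<noteq> 0 \<Longrightarrow> deriv_x (Fract a b) = Fract (map_poly pderiv a * b - a * map_poly pderiv b) (b\<^sup>2)"
  by (simp add: deriv_x_def quotient_rule_Fract map_poly_pderiv_mult)

lemma deriv_y_Fract:
  "b \<noteq> 0 \<Longrightarrow> deriv_y (Fract a b) = Fract (pderiv a * b - a * pderiv b) (b\<^sup>2)"
  by (simp add: deriv_y_def quotient_rule_Fract pderiv_mult)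

lemma deriv_to_fract:
  "deriv_x (to_fract p) = to_fract (map_poly pderiv p)"
  "deriv_y (to_fract p) = to_fract (pderiv p)"
proof -
  have "map_poly pderiv (1 :: 'a poly poly) = 0"
    by (simp add: one_pCons map_poly_pCons)
  then show "deriv_x (to_fract p) = to_fract (map_poly pderiv p)"
    by (simp add: to_fract_def deriv_x_Fract)
qed (simp add: to_fract_def deriv_y_Fract)

lemma bracket_varx_vary: "bracket f varx vary = f"
  by (simp add: bracket_def varx_def vary_def deriv_to_fract pderiv_pCons map_poly_pCons
      flip: one_pCons)


section \<open>Denominators with respect to fractional frames\<close>

inductive_set subalg :: "'k::field ratfun2 \<times> 'k ratfun2 \<Rightarrow> 'k ratfun2 set"
  for s :: "'k ratfun2 \<times> 'k ratfun2" where
  const: "const2 c \<in> subalg s"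
| gen1: "fst s \<in> subalg s"
| gen2: "snd s \<in> subalg s"
| add: "a \<in> subalg s \<Longrightarrow> b \<in> subalg s \<Longrightarrow> a + b \<in> subalg s"
| mult: "a \<in> subalg s \<Longrightarrow> b \<in> subalg s \<Longrightarrow> a * b \<in> subalg s"

definition fractional_frame :: "'k::field ratfun2 \<times> 'k ratfun2 \<Rightarrow> bool" where
  "fractional_frame s \<longleftrightarrow> {a / b | a b. a \<in> subalg s \<and> b \<in> subalg s \<and> b \<noteq> 0} = UNIV"

text \<open>Divisibility in a subring \<open>A\<close> of a field; the definitions follow those of
  \<^const>\<open>dvd\<close>, \<^const>\<open>coprime\<close> and \<^const>\<open>prime_elem\<close>.\<close>

definition dvd_in :: "'a::field set \<Rightarrow> 'a \<Rightarrow> 'a \<Rightarrow> bool" where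
  "dvd_in A a b \<longleftrightarrow> (\<exists>c\<in>A. b = a * c)"

definition coprime_in :: "'a::field set \<Rightarrow> 'a \<Rightarrow> 'a \<Rightarrow> bool" where
  "coprime_in A a b \<longleftrightarrow> (\<forall>c\<in>A. dvd_in A c a \<longrightarrow> dvd_in A c b \<longrightarrow> dvd_in A c 1)"

definition prime_in :: "'a::field set \<Rightarrow> 'a \<Rightarrow> bool" where
  "prime_in A p \<longleftrightarrow> p \<in> A \<and> p \<noteq> 0 \<and> \<not> dvd_in A p 1 \<and>
     (\<forall>a\<in>A. \<forall>b\<in>A. dvd_in A p (a * b) \<longrightarrow> dvd_in A p a \<or> dvd_in A p b)"

text \<open>The number of primes dividing \<open>b\<close> up to association, i.e. the number of association
  classes. It is used for \<open>b \<noteq> 0\<close> only, where it is the \<open>v\<close> of a factorisation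
  \<open>p\<^sub>1 ^ m\<^sub>1 * \<dots> * p\<^sub>v ^ m\<^sub>v\<close> of \<open>b\<close> into powers of non-associate primes.\<close>

definition prime_count_in :: "'a::field set \<Rightarrow> 'a \<Rightarrow> nat" where
  "prime_count_in A b =
     card ((\<lambda>p. {q \<in> A. dvd_in A p q \<and> dvd_in A q p}) ` {p. prime_in A p \<and> dvd_in A p b})"

definition dpb :: "'k::field ratfun2 \<Rightarrow> nat" where
  "dpb h = (LEAST v. \<exists>s f g. fractional_frame s \<and> f \<in> subalg s \<and> g \<in> subalg s \<and> g \<noteq> 0 \<and>
     coprime_in (subalg s) f g \<and> h = f / g \<and> v = prime_count_in (subalg s) g)"

definition prime_count :: "'a::algebraic_semidom \<Rightarrow> nat" where
  "prime_count b = card ((\<lambda>p. {q. p dvd q \<and> q dvd p}) ` {p. prime_elem p \<and> p dvd b})"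

definition Gset :: "nat \<Rightarrow> 'k::field ratfun2 set" where
  "Gset w = {g. \<exists>a b. coprime a b \<and> b \<noteq> 0 \<and> g = Fract a b \<and> prime_count b \<le> w}"


section \<open>The standard frame\<close>

text \<open>For the frame \<open>(x, y)\<close> the notions relative to \<^const>\<open>subalg\<close> are the usual ones
  of the polynomial ring.\<close>

lemma subalg_standard_poly_in: "to_fract [:p:] \<in> subalg (varx, vary)"
  for p :: "'k::field poly"
proof (induction p)
  case 0
  show ?case using subalg.const[of 0 "(varx, vary)"] by (simp add: const2_def)
next
  case (pCons c p)
  have "to_fract [:pCons c p:] = const2 c + varx * to_fract [:p:]"
    by (simp add: const2_def varx_def flip: to_fract_add to_fract_mult)
  moreover have "varx \<in> subalg (varx, vary :: 'k ratfun2)"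
    using subalg.gen1[of "(varx, vary)"] by simp
  ultimately show ?case
    using pCons by (auto intro: subalg.intros)
qed

lemma subalg_standard_in: "to_fract p \<in> subalg (varx, vary)"
  for p :: "'k::field poly poly"
proof (induction p)
  case 0
  show ?case using subalg_standard_poly_in[of 0] by simp
next
  case (pCons c p)
  have "to_fract (pCons c p) = to_fract [:c:] + vary * to_fract p"
    by (simp add: vary_def flip: to_fract_add to_fract_mult)
  moreover have "vary \<in> subalg (varx, vary :: 'k ratfun2)"
    using subalg.gen2[of "(varx, vary)"] by simp
  ultimately show ?case
    using pCons subalg_standard_poly_in[of c] by (auto intro: subalg.intros)
qed

lemma subalg_standard: "subalg (varx, vary :: 'k::field ratfun2) = range to_fract"
proof
  have "a \<in> range to_fract" if "a \<in> subalg (varx, vary)" for a :: "'k ratfun2"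
    using that
  proof induction
    case (add a b)
    then show ?case by (auto simp flip: to_fract_add)
  next
    case (mult a b)
    then show ?case by (auto simp flip: to_fract_mult)
  qed (auto simp: const2_def varx_def vary_def)
  then show "subalg (varx, vary :: 'k ratfun2) \<subseteq> range to_fract" by blast
qed (auto intro: subalg_standard_in)

lemma fractional_frame_standard: "fractional_frame (varx, vary :: 'k::field ratfun2)"
proof -
  have "h \<in> {a / b | a b. a \<in> range to_fract \<and> b \<in> range to_fract \<and> b \<noteq> 0}" for h :: "'k ratfun2"
    by (cases h) (use to_fract_eq_0_iff in \<open>fastforce simp: Fract_conv_to_fract\<close>)
  then show ?thesis unfolding fractional_frame_def subalg_standard by blast
qed

lemma dvd_in_standard:
  "dvd_in (range to_fract) (to_fract a) (to_fract b) \<longleftrightarrow> a dvd b"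
  by (simp add: dvd_in_def dvd_def flip: to_fract_mult)

lemma coprime_in_standard:
  "coprime_in (range to_fract) (to_fract a) (to_fract b) \<longleftrightarrow> coprime a b"
  for a b :: "'a::{idom, algebraic_semidom}"
  using dvd_in_standard[of _ "1 :: 'a"] by (simp add: coprime_in_def coprime_def dvd_in_standard)

lemma prime_in_standard:
  "prime_in (range to_fract) (to_fract p) \<longleftrightarrow> prime_elem p"
  using dvd_in_standard[of p 1]
  by (simp add: prime_in_def prime_elem_def dvd_in_standard flip: to_fract_mult)

lemma prime_count_in_standard:
  "prime_count_in (range to_fract) (to_fract b) = prime_count b"
  for b :: "'a::{idom, algebraic_semidom}"
proof -
  let ?R = "range (to_fract :: 'a \<Rightarrow> _)"
  have "{p. prime_in ?R p \<and> dvd_in ?R p (to_fract b)} = to_fract ` {p. prime_elem p \<and> p dvd b}"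
  proof (intro equalityI subsetI)
    fix x assume x: "x \<in> {p. prime_in ?R p \<and> dvd_in ?R p (to_fract b)}"
    then obtain p where "x = to_fract p" by (auto simp: prime_in_def)
    with x show "x \<in> to_fract ` {p. prime_elem p \<and> p dvd b}"
      by (simp add: prime_in_standard dvd_in_standard)
  qed (auto simp: prime_in_standard dvd_in_standard)
  moreover have "{q \<in> ?R. dvd_in ?R (to_fract p) q \<and> dvd_in ?R q (to_fract p)} =
      to_fract ` {q. p dvd q \<and> q dvd p}" for p
    by (auto simp: dvd_in_standard)
  ultimately have "prime_count_in ?R (to_fract b) =
      card ((`) to_fract ` (\<lambda>p. {q. p dvd q \<and> q dvd p}) ` {p. prime_elem p \<and> p dvd b})"
    by (simp add: prime_count_in_def image_image)
  also have "\<dots> = prime_count b"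
    unfolding prime_count_def
    by (rule card_image) (simp add: inj_on_def inj_image_eq_iff[of to_fract])
  finally show ?thesis .
qed

end

theory Submission
  imports Defs
begin

text \<open>
  Suppose \<open>\<phi>\<close> is a morphism from \<open>K{x y f(h)}\<close> to \<open>K{g}\<close>, and put \<open>X = \<phi>(x)\<close>, \<open>Y = \<phi>(y)\<close>,
  \<open>H = \<phi>(h)\<close>. Then \<open>f(H) = g J(X, Y) / (X Y)\<close> with the Jacobian \<open>J\<close>. As the denominator of \<open>H\<close> has
  more prime divisors than that of \<open>g\<close>, some prime \<open>p\<close> divides the former but not the latter. Now
  \<open>J(X, Y) / (X Y)\<close> is the coefficient of \<open>dlog X \<and> dlog Y\<close>, which has at most a simple pole along
  \<open>p\<close>, whereas \<open>f(H)\<close> has a pole of order at least \<open>degree f \<ge> 2\<close>.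
\<close>

section \<open>Polynomials in two variables\<close>

text \<open>Additive on products and zero only on units (and at \<open>0\<close>). Descent on this size replaces unique
  factorisation, which the libraries provide over fields with a normalised gcd only.\<close>

definition lead_size :: "'k::field poly poly \<Rightarrow> nat" where
  "lead_size q = degree q + degree (lead_coeff q)"

lemma lead_size_mult:
  "a \<noteq> 0 \<Longrightarrow> b \<noteq> 0 \<Longrightarrow> lead_size (a * b) = lead_size a + lead_size b"
  unfolding lead_size_def lead_coeff_mult by (simp add: degree_mult_eq)

lemma lead_size_eq_0_is_unit:
  assumes "lead_size q = 0" "q \<noteq> 0"
  shows "q dvd 1"
proof -
  have "degree q = 0" "degree (lead_coeff q) = 0"
    using assms(1) unfolding lead_size_def by linarith+
  then obtain c where "q = [:[:c:]:]"
    by (metis degree_eq_zeroE coeff_pCons_0)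
  then have "1 = q * [:[:inverse c:]:]"
    using assms(2) by (simp add: one_pCons)
  then show ?thesis ..
qed

text \<open>This is the descent step: cancelling a nonunit factor strictly lowers the size.\<close>

lemma lead_size_cofactor_less:
  assumes "a * b \<noteq> 0" "\<not> a dvd 1"
  shows "lead_size b < lead_size (a * b)"
  using assms lead_size_mult[of a b] lead_size_eq_0_is_unit[of a] by fastforce

lemma prime_elem_cofactor_less:
  "prime_elem p \<Longrightarrow> p * b \<noteq> 0 \<Longrightarrow> lead_size b < lead_size (p * b)"
  by (intro lead_size_cofactor_less) (auto simp: prime_elem_def)

text \<open>Removing one prime factor \<open>p\<close> from \<open>b\<close> loses at most the class
  of \<open>p\<close>, so induction on the size applies. Finiteness matters because
  \<open>card\<close> of an infinite set is 0, which would break comparisons of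
  \<open>prime_count\<close>.\<close>

lemma finite_prime_classes:
  fixes b :: "'k::field poly poly"
  assumes "b \<noteq> 0"
  shows "finite ((\<lambda>p. {q. p dvd q \<and> q dvd p}) ` {p. prime_elem p \<and> p dvd b})"
  using assms
proof (induction "lead_size b" arbitrary: b rule: less_induct)
  case less
  let ?cls = "\<lambda>p :: 'k poly poly. {q. p dvd q \<and> q dvd p}"
  show ?case
  proof (cases "\<exists>p. prime_elem p \<and> p dvd b")
    case True
    then obtain p c where p: "prime_elem p" and b: "b = p * c"
      by (auto elim: dvdE)
    have "?cls ` {q. prime_elem q \<and> q dvd b} \<subseteq> insert (?cls p) (?cls ` {q. prime_elem q \<and> q dvd c})"
    proof
      fix S assume "S \<in> ?cls ` {q. prime_elem q \<and> q dvd b}"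
      then obtain q where q: "prime_elem q" "q dvd b" and S: "S = ?cls q" by blast
      show "S \<in> insert (?cls p) (?cls ` {q. prime_elem q \<and> q dvd c})"
      proof (cases "q dvd c")
        case False
        then have qp: "q dvd p"
          using q b by (auto simp: prime_elem_dvd_mult_iff)
        then obtain r where r: "p = q * r" ..
        \<comment> \<open>If \<open>p\<close> divided \<open>r\<close>, then \<open>r\<close> would
          be at least as large as \<open>p\<close>; but as a cofactor of the prime \<open>q\<close>
          in \<open>p\<close> it is strictly smaller.\<close>
        have "\<not> p dvd r"
          using p q r prime_elem_cofactor_less[of q r] lead_size_mult[of p] by (auto elim!: dvdE)
        then have "p dvd q"
          using p r by (metis dvd_refl prime_elem_dvd_mult_iff)
        with qp have "?cls q = ?cls p"
          by (auto intro: dvd_trans)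
        with S show ?thesis by simp
      qed (use q S in blast)
    qed
    moreover have "finite (?cls ` {q. prime_elem q \<and> q dvd c})"
      using less.hyps[of c] less.prems p b prime_elem_cofactor_less[of p c] by auto
    ultimately show ?thesis
      by (auto intro: finite_subset)
  next
    case False
    then have "{p. prime_elem p \<and> p dvd b} = {}" by blast
    then show ?thesis by (simp only: image_empty finite.emptyI)
  qed
qed

lemma prime_count_mono:
  fixes b :: "'k::field poly poly"
  assumes "b \<noteq> 0" and "\<And>p. prime_elem p \<Longrightarrow> p dvd a \<Longrightarrow> p dvd b"
  shows "prime_count a \<le> prime_count b"
  unfolding prime_count_def
  by (rule card_mono[OF finite_prime_classes[OF assms(1)]]) (use assms(2) in blast)

text \<open>Among all denominators of \<open>H\<close>, one of least size is taken; cancelling a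
  common nonunit factor would produce a smaller one.\<close>

lemma coprime_fraction:
  fixes H :: "'k::field ratfun2"
  obtains a b where "H = to_fract a / to_fract b" "b \<noteq> 0" "coprime a b"
proof -
  let ?den = "\<lambda>b. b \<noteq> 0 \<and> (\<exists>a. H = to_fract a / to_fract b)"
  have "\<exists>b. ?den b"
    by (cases H) (auto simp: Fract_conv_to_fract)
  then obtain b where b: "?den b" and min: "\<And>d. ?den d \<Longrightarrow> lead_size b \<le> lead_size d"
    using ex_has_least_nat[of ?den _ lead_size] by blast
  then obtain a where H: "H = to_fract a / to_fract b" by blast
  have "coprime a b"
  proof (rule coprimeI)
    fix c assume "c dvd a" "c dvd b"
    then obtain a' b' where ab: "a = c * a'" "b = c * b'" by (auto elim!: dvdE)
    then have "?den b'"
      using b H by (auto simp: to_fract_mult)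
    then show "c dvd 1"
      using min[of b'] lead_size_cofactor_less[of c b'] b ab by auto
  qed
  with H b that show ?thesis by blast
qed

text \<open>The standard frame is one competitor in the minimum that defines
  \<open>dpb\<close>.\<close>

lemma dpb_le_prime_count:
  fixes a b :: "'k::field poly poly"
  assumes "b \<noteq> 0" "coprime a b"
  shows "dpb (to_fract a / to_fract b) \<le> prime_count b"
  unfolding dpb_def
proof (rule Least_le, intro exI conjI)
  show "fractional_frame (varx, vary :: 'k ratfun2)"
    by (rule fractional_frame_standard)
  show "prime_count b = prime_count_in (subalg (varx, vary :: 'k ratfun2)) (to_fract b)"
    unfolding subalg_standard by (rule prime_count_in_standard[symmetric])
qed (use assms in \<open>simp_all add: subalg_standard coprime_in_standard\<close>)

section \<open>Localisation at a prime\<close>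

text \<open>For prime \<open>p\<close> this is the local ring at \<open>p\<close>. Membership
  expresses the absence of a pole along \<open>p\<close> and stands in for a valuation.\<close>

definition localization :: "'a::idom \<Rightarrow> 'a fract set" where
  "localization p = {to_fract a / to_fract b | a b. \<not> p dvd b}"

lemma localizationI: "\<not> p dvd b \<Longrightarrow> to_fract a / to_fract b \<in> localization p"
  by (auto simp: localization_def)

lemma to_fract_in_localization: "prime_elem p \<Longrightarrow> to_fract a \<in> localization p"
  using localizationI[of p 1 a] by (simp add: prime_elem_def)

lemma localization_add:
  assumes "prime_elem p" "r \<in> localization p" "s \<in> localization p"
  shows "r + s \<in> localization p"
proof -
  obtain a b c d where rs: "r = to_fract a / to_fract b" "s = to_fract c / to_fract d"
    and nd: "\<not> p dvd b" "\<not> p dvd d"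
    using assms by (auto simp: localization_def)
  then have "b \<noteq> 0" "d \<noteq> 0" by auto
  then have "r + s = to_fract (a * d + c * b) / to_fract (b * d)"
    by (simp add: rs add_frac_eq)
  then show ?thesis
    using nd assms(1) by (simp only: localizationI prime_elem_dvd_mult_iff simp_thms)
qed

lemma localization_mult:
  assumes "prime_elem p" "r \<in> localization p" "s \<in> localization p"
  shows "r * s \<in> localization p"
proof -
  obtain a b c d where rs: "r = to_fract a / to_fract b" "s = to_fract c / to_fract d"
    and nd: "\<not> p dvd b" "\<not> p dvd d"
    using assms by (auto simp: localization_def)
  then have "r * s = to_fract (a * c) / to_fract (b * d)"
    by simp
  then show ?thesis
    using nd assms(1) by (simp only: localizationI prime_elem_dvd_mult_iff simp_thms)
qed

lemma localization_uminus: "prime_elem p \<Longrightarrow> r \<in> localization p \<Longrightarrow> - r \<in> localization p"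
  using localization_mult[of p "to_fract (- 1)" r] to_fract_in_localization[of p "- 1"]
  by simp

lemma localization_diff:
  "prime_elem p \<Longrightarrow> r \<in> localization p \<Longrightarrow> s \<in> localization p \<Longrightarrow> r - s \<in> localization p"
  using localization_add[of p r "- s"] localization_uminus[of p s] by simp

lemma localization_power:
  "prime_elem p \<Longrightarrow> r \<in> localization p \<Longrightarrow> r ^ n \<in> localization p"
  using to_fract_in_localization[of p 1] by (induction n) (simp_all add: localization_mult)

lemmas localization_intros =
  localization_add localization_mult localization_diff localization_power to_fract_in_localization

lemma prime_not_unit_in_localization:
  assumes "s \<in> localization p"
  shows "to_fract p * s \<noteq> 1"
proof
  assume eq: "to_fract p * s = 1"
  obtain a b where s: "s = to_fract a / to_fract b" and nd: "\<not> p dvd b"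
    using assms by (auto simp: localization_def)
  then have "b \<noteq> 0" by auto
  then have "to_fract (p * a) = to_fract b"
    using eq by (simp add: s field_simps)
  then have "p * a = b" by (simp only: to_fract_eq_iff)
  with nd show False by auto
qed

section \<open>Logarithmic derivatives\<close>

lemma quotient_rule_mult:
  fixes D :: "'a::idom \<Rightarrow> 'a"
  assumes D: "\<And>p q. D (p * q) = p * D q + q * D p"
  shows "quotient_rule D (u * v) = u * quotient_rule D v + v * quotient_rule D u"
proof -
  obtain a b where u: "u = Fract a b" "b \<noteq> 0" by (cases u)
  obtain c d where v: "v = Fract c d" "d \<noteq> 0" by (cases v)
  show ?thesis
    using u v by (simp add: quotient_rule_Fract[OF D] eq_fract D power2_eq_square algebra_simps)
qed

lemma deriv_mult:
  "deriv_x (u * v) = u * deriv_x v + v * deriv_x u"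
  "deriv_y (u * v) = u * deriv_y v + v * deriv_y u"
  by (simp_all add: deriv_x_def deriv_y_def quotient_rule_mult map_poly_pderiv_mult pderiv_mult)

text \<open>\<open>dlog X = i dp / p + (\<alpha> dx + \<beta> dy)\<close>; here \<open>i\<close> is the order of \<open>X\<close> along \<open>p\<close>, but all that matters
  is that the same \<open>i\<close> serves both partial derivatives.\<close>

definition log_pole :: "'k::field poly poly \<Rightarrow> 'k ratfun2 \<Rightarrow> bool" where
  "log_pole p X \<longleftrightarrow> (\<exists>i \<in> localization p. \<exists>\<alpha> \<in> localization p. \<exists>\<beta> \<in> localization p.
     deriv_x X = X * (i * deriv_x (to_fract p) / to_fract p + \<alpha>) \<and>
     deriv_y X = X * (i * deriv_y (to_fract p) / to_fract p + \<beta>))"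

text \<open>Factors \<open>p\<close> are split off one at a time, each raising \<open>i\<close> by
  1. Once \<open>p\<close> no longer divides \<open>a\<close>, the logarithmic derivatives of
  \<open>a\<close> are regular and \<open>i = 0\<close> works.\<close>

lemma log_pole_to_fract:
  assumes p: "prime_elem p" and "a \<noteq> 0"
  shows "log_pole p (to_fract a)"
  using assms(2)
proof (induction "lead_size a" arbitrary: a rule: less_induct)
  case less
  have p0: "to_fract p \<noteq> 0" using p by (auto simp: prime_elem_def)
  have one: "1 \<in> localization p" using to_fract_in_localization[OF p, of 1] by simp
  show ?case
  proof (cases "p dvd a")
    case True
    then obtain c where a: "a = p * c" ..
    then have "log_pole p (to_fract c)"
      using less prime_elem_cofactor_less[OF p, of c] by auto
    then obtain i \<alpha> \<beta> where i: "i \<in> localization p" "\<alpha> \<in> localization p" "\<beta> \<in> localization p"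
      and eq: "deriv_x (to_fract c) = to_fract c * (i * deriv_x (to_fract p) / to_fract p + \<alpha>)"
        "deriv_y (to_fract c) = to_fract c * (i * deriv_y (to_fract p) / to_fract p + \<beta>)"
      unfolding log_pole_def by blast
    have "i + 1 \<in> localization p"
      using i one p by (intro localization_intros)
    then show ?thesis
      unfolding log_pole_def a to_fract_mult deriv_mult eq
      by (intro bexI[of _ "i + 1"] bexI[of _ \<alpha>] bexI[of _ \<beta>] conjI)
        (use i p0 in \<open>simp_all add: field_simps\<close>)
  next
    case False
    have "deriv_x (to_fract a) / to_fract a \<in> localization p"
      "deriv_y (to_fract a) / to_fract a \<in> localization p"
      using False by (simp_all add: deriv_to_fract localizationI)
    moreover have "0 \<in> localization p"
      using to_fract_in_localization[OF p, of 0] by simp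
    ultimately show ?thesis
      unfolding log_pole_def
      by (intro bexI[of _ 0] bexI[of _ "deriv_x (to_fract a) / to_fract a"]
          bexI[of _ "deriv_y (to_fract a) / to_fract a"] conjI) (use less in simp_all)
  qed
qed

text \<open>The logarithmic derivative of a quotient is the difference of those of numerator and
  denominator.\<close>

lemma log_pole_nonzero:
  assumes p: "prime_elem p" and "X \<noteq> 0"
  shows "log_pole p X"
proof -
  have p0: "to_fract p \<noteq> 0" using p by (auto simp: prime_elem_def)
  obtain a b where "X = to_fract a / to_fract b" and b: "b \<noteq> 0"
    by (cases X) (auto simp: Fract_conv_to_fract)
  with \<open>X \<noteq> 0\<close> have a: "a \<noteq> 0" and aX: "to_fract a = X * to_fract b" by auto
  from log_pole_to_fract[OF p a] obtain i \<alpha> \<beta>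
    where i: "i \<in> localization p" "\<alpha> \<in> localization p" "\<beta> \<in> localization p"
      and eqa: "deriv_x (to_fract a) = to_fract a * (i * deriv_x (to_fract p) / to_fract p + \<alpha>)"
        "deriv_y (to_fract a) = to_fract a * (i * deriv_y (to_fract p) / to_fract p + \<beta>)"
    unfolding log_pole_def by blast
  from log_pole_to_fract[OF p b] obtain j \<gamma> \<delta>
    where j: "j \<in> localization p" "\<gamma> \<in> localization p" "\<delta> \<in> localization p"
      and eqb: "deriv_x (to_fract b) = to_fract b * (j * deriv_x (to_fract p) / to_fract p + \<gamma>)"
        "deriv_y (to_fract b) = to_fract b * (j * deriv_y (to_fract p) / to_fract p + \<delta>)"
    unfolding log_pole_def by blast
  \<comment> \<open>The product rule for \<open>X * to_fract b\<close> is solved for the derivative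
    \<open>D\<close> of \<open>X\<close>; \<open>r\<close> is the same derivative of
    \<open>p\<close>, so both partial derivatives are covered.\<close>
  have quot: "D = X * ((i - j) * r / to_fract p + (\<mu> - \<nu>))"
    if "X * (to_fract b * (j * r / to_fract p + \<nu>)) + to_fract b * D =
        X * to_fract b * (i * r / to_fract p + \<mu>)" for D r \<mu> \<nu>
  proof -
    have "to_fract b * D = to_fract b * (X * ((i - j) * r / to_fract p + (\<mu> - \<nu>)))"
      using that by (simp add: algebra_simps diff_divide_distrib)
    with b show ?thesis by simp
  qed
  have "deriv_x X = X * ((i - j) * deriv_x (to_fract p) / to_fract p + (\<alpha> - \<gamma>))"
    using eqa(1) unfolding aX deriv_mult eqb by (rule quot)
  moreover have "deriv_y X = X * ((i - j) * deriv_y (to_fract p) / to_fract p + (\<beta> - \<delta>))"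
    using eqa(2) unfolding aX deriv_mult eqb by (rule quot)
  moreover have "i - j \<in> localization p" "\<alpha> - \<gamma> \<in> localization p" "\<beta> - \<delta> \<in> localization p"
    using i j p by (auto intro: localization_intros)
  ultimately show ?thesis
    unfolding log_pole_def by blast
qed

text \<open>Both logarithmic differentials have polar part a multiple of \<open>dp / p\<close>, and
  the wedge of \<open>dp / p\<close> with itself vanishes, so no double pole arises.\<close>

lemma log_jacobian_simple_pole:
  assumes p: "prime_elem p" and "X \<noteq> 0" "Y \<noteq> 0"
  shows "to_fract p * ((deriv_x X * deriv_y Y - deriv_y X * deriv_x Y) / (X * Y)) \<in> localization p"
proof -
  have p0: "to_fract p \<noteq> 0" using p by (auto simp: prime_elem_def)
  let ?u = "deriv_x (to_fract p)" and ?v = "deriv_y (to_fract p)"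
  from log_pole_nonzero[OF p \<open>X \<noteq> 0\<close>] obtain i \<alpha> \<beta>
    where i: "i \<in> localization p" "\<alpha> \<in> localization p" "\<beta> \<in> localization p"
      and X: "deriv_x X = X * (i * ?u / to_fract p + \<alpha>)" "deriv_y X = X * (i * ?v / to_fract p + \<beta>)"
    unfolding log_pole_def by blast
  from log_pole_nonzero[OF p \<open>Y \<noteq> 0\<close>] obtain j \<gamma> \<delta>
    where j: "j \<in> localization p" "\<gamma> \<in> localization p" "\<delta> \<in> localization p"
      and Y: "deriv_x Y = Y * (j * ?u / to_fract p + \<gamma>)" "deriv_y Y = Y * (j * ?v / to_fract p + \<delta>)"
    unfolding log_pole_def by blast
  have "(deriv_x X * deriv_y Y - deriv_y X * deriv_x Y) / (X * Y) =
      (i * ?u / to_fract p + \<alpha>) * (j * ?v / to_fract p + \<delta>) -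
      (i * ?v / to_fract p + \<beta>) * (j * ?u / to_fract p + \<gamma>)"
    using assms(2,3) unfolding X Y by (simp add: diff_divide_distrib)
  \<comment> \<open>The two terms with \<open>p\<close> squared in the denominator, each
    \<open>i * j * ?u * ?v\<close>, cancel.\<close>
  also have "to_fract p * \<dots> =
      i * ?u * \<delta> + \<alpha> * (j * ?v) - i * ?v * \<gamma> - \<beta> * (j * ?u) + to_fract p * (\<alpha> * \<delta> - \<beta> * \<gamma>)"
    using p0 by (simp add: field_simps)
  also have "\<dots> \<in> localization p"
    using i j p unfolding deriv_to_fract by (intro localization_intros)
  finally show ?thesis .
qed

section \<open>Evaluation of polynomials in one variable\<close>

lemma const2_0: "const2 0 = 0" and const2_1: "const2 1 = 1"
  and const2_mult: "const2 (c * d) = const2 c * const2 d"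
  by (simp_all add: const2_def flip: one_pCons to_fract_mult)

lemma eval_at_0: "eval_at 0 H = 0"
  by (simp add: eval_at_def)

lemma eval_at_pCons: "eval_at (pCons c q) H = const2 c + H * eval_at q H"
  by (cases "pCons c q = 0") (auto simp: eval_at_def map_poly_pCons const2_0)

lemma algebra_map_eval_at:
  assumes "algebra_map \<phi>"
  shows "\<phi> (eval_at q H) = eval_at q (\<phi> H)"
proof (induction q)
  case 0
  have "\<phi> (const2 0) = const2 0" using assms unfolding algebra_map_def by blast
  then show ?case by (simp add: eval_at_0 const2_0)
next
  case (pCons c q)
  then show ?case using assms by (simp add: eval_at_pCons algebra_map_def)
qed

lemma algebra_map_nonzero:
  assumes "algebra_map \<phi>" "X \<noteq> 0"
  shows "\<phi> X \<noteq> 0"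
proof
  assume "\<phi> X = 0"
  have "1 = \<phi> (const2 1)" using assms(1) by (metis algebra_map_def const2_1)
  also have "\<dots> = \<phi> (X * inverse X)" using assms(2) by (simp add: const2_1)
  also have "\<dots> = \<phi> X * \<phi> (inverse X)" using assms(1) by (simp add: algebra_map_def)
  finally show False using \<open>\<phi> X = 0\<close> by simp
qed

text \<open>With \<open>U = to_fract p * t\<close>, the inverse of \<open>H\<close>, multiplying by
  \<open>U ^ degree q\<close> yields the reversed polynomial at \<open>U\<close>. Its constant term
  is the leading coefficient of \<open>q\<close>, and all other terms are divisible by
  \<open>p\<close>.\<close>

lemma eval_at_leading_term:
  assumes p: "prime_elem p" and t: "t \<in> localization p" and H: "H * (to_fract p * t) = 1"
    and "q \<noteq> 0"
  shows "\<exists>s \<in> localization p.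
    eval_at q H * (to_fract p * t) ^ degree q = const2 (lead_coeff q) + to_fract p * s"
  using assms(4)
proof (induction q)
  case (pCons c q)
  have const_in: "const2 d \<in> localization p" for d
    unfolding const2_def by (rule to_fract_in_localization[OF p])
  show ?case
  proof (cases "q = 0")
    case True
    moreover have "0 \<in> localization p" using const_in[of 0] by (simp add: const2_0)
    ultimately show ?thesis
      by (intro bexI[of _ 0]) (simp_all add: eval_at_pCons eval_at_0)
  next
    case False
    let ?U = "to_fract p * t"
    obtain s where s: "s \<in> localization p"
      and eq: "eval_at q H * ?U ^ degree q = const2 (lead_coeff q) + to_fract p * s"
      using pCons.IH[OF False] by blast
    \<comment> \<open>The degree grows by one; the extra \<open>?U\<close> cancels the new factor
      \<open>H\<close> and makes the term of \<open>c\<close> divisible by \<open>p\<close>.\<close>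
    have "eval_at (pCons c q) H * ?U ^ degree (pCons c q) =
        const2 c * ?U * ?U ^ degree q + (H * ?U) * (eval_at q H * ?U ^ degree q)"
      using False by (simp add: eval_at_pCons algebra_simps)
    also have "\<dots> = const2 (lead_coeff (pCons c q)) + to_fract p * (s + const2 c * t * ?U ^ degree q)"
      unfolding H eq using False by (simp add: algebra_simps)
    finally show ?thesis
      by (rule bexI) (use p s t const_in in \<open>auto intro!: localization_intros\<close>)
  qed
qed simp

text \<open>Were the pole simple, the leading coefficient, a nonzero constant, would be a multiple
  of \<open>p\<close> in the local ring, and \<open>p\<close> would be invertible there.\<close>

lemma eval_at_not_simple_pole:
  assumes p: "prime_elem p" and t: "t \<in> localization p" and H: "H * (to_fract p * t) = 1"
    and deg: "degree q \<ge> 2"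
  shows "to_fract p * eval_at q H \<notin> localization p"
proof
  assume simple: "to_fract p * eval_at q H \<in> localization p"
  have q0: "q \<noteq> 0" using deg by auto
  obtain s where s: "s \<in> localization p"
    and eq: "eval_at q H * (to_fract p * t) ^ degree q = const2 (lead_coeff q) + to_fract p * s"
    using eval_at_leading_term[OF p t H q0] by blast
  \<comment> \<open>Degree at least 2 supplies two factors \<open>p\<close>: one makes
    \<open>eval_at q H\<close> regular, the other is left over to divide the leading
    coefficient.\<close>
  obtain n where n: "degree q = Suc (Suc n)"
    using deg by (metis Suc_le_D numeral_2_eq_2 Suc_le_mono)
  define e where "e = to_fract p * eval_at q H"
  define r where "r = e * t * t * (to_fract p * t) ^ n - s"
  have r: "r \<in> localization p"
    unfolding r_def using simple[folded e_def] s t p by (intro localization_intros)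
  have c: "const2 (lead_coeff q) = to_fract p * r"
    using eq unfolding n r_def e_def by (simp add: algebra_simps)
  have "to_fract p * (const2 (inverse (lead_coeff q)) * r) =
      const2 (inverse (lead_coeff q)) * const2 (lead_coeff q)"
    unfolding c by simp
  also have "\<dots> = 1"
    using q0 by (simp add: const2_1 flip: const2_mult)
  finally show False
    using prime_not_unit_in_localization[of "const2 (inverse (lead_coeff q)) * r" p] r p
    by (simp add: localization_mult to_fract_in_localization const2_def)
qed

section \<open>Comparing poles along a prime that separates the two denominators\<close>

theorem theorem8p6:
  fixes w :: nat
    and h :: "'k::field_char_0 ratfun2"
    and f :: "'k poly"
  assumes "h \<noteq> 0"
    and "\<And>\<phi> :: 'k ratfun2 \<Rightarrow> 'k ratfun2. algebra_map \<phi> \<Longrightarrow> dpb (\<phi> h) > w"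
    and "degree f \<ge> 2"
  shows "\<not> (\<exists>g \<in> Gset w. \<exists>\<phi>. poisson_morphism (varx * vary * eval_at f h) g \<phi>)"
proof
  assume "\<exists>g \<in> Gset w. \<exists>\<phi>. poisson_morphism (varx * vary * eval_at f h) g \<phi>"
  then obtain g \<phi> where g: "g \<in> Gset w"
    and pm: "poisson_morphism (varx * vary * eval_at f h) g \<phi>" by blast
  then have am: "algebra_map \<phi>" by (simp add: poisson_morphism_def)
  define X where "X = \<phi> varx"
  define Y where "Y = \<phi> vary"
  have XY: "X \<noteq> 0" "Y \<noteq> 0"
    unfolding X_def Y_def by (auto intro!: algebra_map_nonzero[OF am] simp: varx_def vary_def)
  \<comment> \<open>Only the bracket of the two generators is needed: it is the structure element
    itself.\<close>
  have "X * Y * eval_at f (\<phi> h) = \<phi> (bracket (varx * vary * eval_at f h) varx vary)"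
    using am by (simp add: bracket_varx_vary algebra_map_def X_def Y_def
        flip: algebra_map_eval_at[OF am])
  also have "\<dots> = bracket g X Y"
    using pm by (simp add: poisson_morphism_def X_def Y_def)
  finally have eval: "eval_at f (\<phi> h) =
      (deriv_x X * deriv_y Y - deriv_y X * deriv_x Y) / (X * Y) * g"
    using XY by (simp add: bracket_def field_simps)
  obtain a b where b: "b \<noteq> 0" "prime_count b \<le> w" and gab: "g = to_fract a / to_fract b"
    using g by (auto simp: Gset_def Fract_conv_to_fract)
  obtain P Q where H: "\<phi> h = to_fract P / to_fract Q" and Q: "Q \<noteq> 0" "coprime P Q"
    by (rule coprime_fraction)
  have "prime_count b < prime_count Q"
    using assms(2)[OF am] dpb_le_prime_count[OF Q] b(2) unfolding H by linarith
  \<comment> \<open>If every prime divisor of \<open>Q\<close> divided \<open>b\<close>,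
    \<open>prime_count_mono\<close> would contradict the strict inequality.\<close>
  then obtain p where p: "prime_elem p" "p dvd Q" "\<not> p dvd b"
    using prime_count_mono[OF b(1), of Q] by (metis not_less)
  have P: "\<not> p dvd P"
    using p Q(2) by (auto simp: prime_elem_def coprime_def)
  then have P0: "P \<noteq> 0" by auto
  obtain R where R: "Q = p * R" using p(2) ..
  \<comment> \<open>This fraction is the \<open>t\<close> for which \<open>to_fract p * t\<close>
    inverts \<open>\<phi> h\<close>.\<close>
  have "to_fract R / to_fract P \<in> localization p"
    using P by (rule localizationI)
  moreover have "\<phi> h * (to_fract p * (to_fract R / to_fract P)) = 1"
    using P0 Q(1) unfolding H R by (simp add: field_simps)
  ultimately have "to_fract p * eval_at f (\<phi> h) \<notin> localization p"
    using eval_at_not_simple_pole p(1) assms(3) by blast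
  moreover have "g \<in> localization p"
    unfolding gab using p(3) by (rule localizationI)
  then have "to_fract p * eval_at f (\<phi> h) \<in> localization p"
    unfolding eval using localization_mult[OF p(1) log_jacobian_simple_pole[OF p(1) XY]]
    by (simp add: mult.assoc)
  ultimately show False by contradiction
qed

end
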